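(* Let $P_1=(x_1,y_1),P_2=(x_2,y_2),P_3=(x_3,y_3)\in E\smallsetminus \{O\}$ with $P_1\neq \pm P_2$, $P_2\neq \pm P_3$, $P_1\neq \pm P_3$ and $P_1+P_2\neq \pm P_3$. Then the coordinates of $P_4=(x_4,y_4):=(P_1+P_2)+P_3$ are given by \[ x_4=-x_1-x_2-x_3+(V^2-2c_1c_2)/c_2^2\qquad \text{and}\qquad y_4= -(c_2x_4^2+c_1x_4+c_0)/V.\]
   Context: Let $E=\{ (x,y)\in \mathbb{C}^2 \mid y^2=x^3+ax+b\} \cup \{ O\}$ with $4a^3+27b^2\neq 0$ and $O$ the point at infinity. The addition on $E$ is the usual one: $P+O=O+P=P$; for $P_1=(x_1,y_1),P_2=(x_2,y_2)\in E\smallsetminus\{O\}$, if $x_1=x_2$ and $y_1=-y_2$ then $P_1+P_2=O$; otherwise $P_1+P_2=(x_3,y_3)$ with $x_3= -x_1-x_2+\alpha^2$, $y_3= -y_1-\alpha (x_3-x_1)$, where $\alpha = \frac{y_2-y_1}{x_2-x_1}$ if $x_1\neq x_2$ and $\alpha = \frac{3 x_1^2 +a}{2y_1}$ if $x_1=x_2$, $y_1=y_2$. The inverse of $(x,y)$ is $(x,-y)$. For $P_i=(x_i,y_i)$, $i=1,2,3$, set \[ V:= \det\begin{pmatrix} 1 &x_1&x_1^2\\ 1 & x_2 & x_2^2\\ 1 & x_3 & x_3^2 \end{pmatrix} = (x_1-x_2)(x_2-x_3)(x_3-x_1),\quad c_0:= \det\begin{pmatrix} x_1&x_1^2&y_1\\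 x_2 & x_2^2&y_2\\ x_3 & x_3^2&y_3 \end{pmatrix},\] \[ c_1:= -\det\begin{pmatrix} 1&x_1^2&y_1\\ 1 & x_2^2&y_2\\ 1 & x_3^2&y_3 \end{pmatrix},\qquad c_2:= \det\begin{pmatrix} 1 &x_1&y_1\\ 1 & x_2&y_2\\ 1 & x_3&y_3 \end{pmatrix}.\] *)

theory Defs
  imports "HOL-Analysis.Analysis"
begin

datatype ec_point = At_Infinity | Affine complex complex

definition ec_curve :: "complex \<Rightarrow> complex \<Rightarrow> ec_point set" where
  "ec_curve a b = {Affine x y | x y. y\<^sup>2 = x ^ 3 + a * x + b} \<union> {At_Infinity}"

fun ec_neg :: "ec_point \<Rightarrow> ec_point" where
  "ec_neg At_Infinity = At_Infinity"
| "ec_neg (Affine x y) = Affine x (- y)"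

text \<open>
  The addition is a total function on \<^typ>\<open>ec_point\<close>, meaningful only for two points of the same
  curve \<open>ec_curve a b\<close>; the coefficient \<open>b\<close> does not occur in the formulas. For two such points the
  final \<open>else\<close> branch of \<open>\<alpha>\<close> is reached only if \<open>x\<^sub>1 = x\<^sub>2\<close> and \<open>y\<^sub>1 = y\<^sub>2 \<noteq> 0\<close>.
\<close>

fun ec_add :: "complex \<Rightarrow> ec_point \<Rightarrow> ec_point \<Rightarrow> ec_point" where
  "ec_add a At_Infinity Q = Q"
| "ec_add a (Affine x1 y1) At_Infinity = Affine x1 y1"
| "ec_add a (Affine x1 y1) (Affine x2 y2) =
     (if x1 = x2 \<and> y1 = - y2 then At_Infinity
      else
        let \<alpha> = (if x1 \<noteq> x2 then (y2 - y1) / (x2 - x1) else (3 * x1\<^sup>2 + a) / (2 * y1));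
            x3 = - x1 - x2 + \<alpha>\<^sup>2;
            y3 = - y1 - \<alpha> * (x3 - x1)
        in Affine x3 y3)"

definition det_V :: "complex \<Rightarrow> complex \<Rightarrow> complex \<Rightarrow> complex" where
  "det_V x1 x2 x3 = det (vector
     [vector [1, x1, x1\<^sup>2],
      vector [1, x2, x2\<^sup>2],
      vector [1, x3, x3\<^sup>2]] :: complex ^ 3 ^ 3)"

lemma det_V_eq: "det_V x1 x2 x3 = (x1 - x2) * (x2 - x3) * (x3 - x1)"
  by (simp add: det_V_def det_3 vector_3 power2_eq_square algebra_simps)

definition det_c0 ::
  "complex \<Rightarrow> complex \<Rightarrow> complex \<Rightarrow> complex \<Rightarrow> complex \<Rightarrow> complex \<Rightarrow> complex" where
  "det_c0 x1 y1 x2 y2 x3 y3 = det (vector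
     [vector [x1, x1\<^sup>2, y1],
      vector [x2, x2\<^sup>2, y2],
      vector [x3, x3\<^sup>2, y3]] :: complex ^ 3 ^ 3)"

definition det_c1 ::
  "complex \<Rightarrow> complex \<Rightarrow> complex \<Rightarrow> complex \<Rightarrow> complex \<Rightarrow> complex \<Rightarrow> complex" where
  "det_c1 x1 y1 x2 y2 x3 y3 = - det (vector
     [vector [1, x1\<^sup>2, y1],
      vector [1, x2\<^sup>2, y2],
      vector [1, x3\<^sup>2, y3]] :: complex ^ 3 ^ 3)"

definition det_c2 ::
  "complex \<Rightarrow> complex \<Rightarrow> complex \<Rightarrow> complex \<Rightarrow> complex \<Rightarrow> complex \<Rightarrow> complex" where
  "det_c2 x1 y1 x2 y2 x3 y3 = det (vector
     [vector [1, x1, y1],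
      vector [1, x2, y2],
      vector [1, x3, y3]] :: complex ^ 3 ^ 3)"

end

theory Submission
  imports Defs
begin

text \<open>
  Let \<open>L\<close> be the chord through \<open>P\<^sub>1\<close> and \<open>P\<^sub>2\<close>, let \<open>f\<close> be the cubic, let \<open>u\<close> be the abscissa of
  \<open>P\<^sub>1 + P\<^sub>2\<close>, and let \<open>q = L + k (x - x\<^sub>1) (x - x\<^sub>2)\<close> be the parabola through \<open>P\<^sub>1, P\<^sub>2, P\<^sub>3\<close>; its
  coefficients are \<open>c\<^sub>i / V\<close>. Since \<open>f - L\<^sup>2 = (x - x\<^sub>1) (x - x\<^sub>2) (x - u)\<close>, evaluation at \<open>x\<^sub>3\<close> gives
  \<open>x\<^sub>3 - u = k (y\<^sub>3 + L x\<^sub>3)\<close>. So \<open>k \<noteq> 0\<close>, and the line through \<open>P\<^sub>1 + P\<^sub>2\<close> and \<open>P\<^sub>3\<close> has slope \<open>1/k - \<alpha>\<close>,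
  where \<open>\<alpha>\<close> is the slope of \<open>L\<close>. The formula for \<open>x\<^sub>4\<close> follows, and the one for \<open>y\<^sub>4\<close> says that
  \<open>x\<^sub>4\<close> is the remaining root of \<open>q\<^sup>2 - f\<close>.
\<close>

lemma ec_curve_distinct_abscissae:
  assumes "Affine x1 y1 \<in> ec_curve a b" and "Affine x2 y2 \<in> ec_curve a b"
    and "Affine x1 y1 \<noteq> Affine x2 y2" and "Affine x1 y1 \<noteq> ec_neg (Affine x2 y2)"
  shows "x1 \<noteq> x2"
  using assms by (auto simp: ec_curve_def) (metis power2_eq_iff)

text \<open>Both sides are monic cubics in \<open>x\<close> with equal quadratic coefficients; their
  difference has degree at most 1 and vanishes at \<open>x1\<close> and \<open>x2\<close>.\<close>

lemma chord_cubic_factorization: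
  fixes a b \<alpha> x x1 y1 x2 y2 :: "'a::field"
  assumes "y1\<^sup>2 = x1 ^ 3 + a * x1 + b" and "y2\<^sup>2 = x2 ^ 3 + a * x2 + b"
    and "x1 \<noteq> x2" and "y2 = y1 + \<alpha> * (x2 - x1)"
  shows "x ^ 3 + a * x + b - (y1 + \<alpha> * (x - x1))\<^sup>2 =
    (x - x1) * (x - x2) * (x - (- x1 - x2 + \<alpha>\<^sup>2))"
proof -
  have "(x1 - x2) * (x ^ 3 + a * x + b - (y1 + \<alpha> * (x - x1))\<^sup>2) =
    (x1 - x2) * ((x - x1) * (x - x2) * (x - (- x1 - x2 + \<alpha>\<^sup>2)))"
    using assms(1,2,4) by algebra
  then show ?thesis
    using \<open>x1 \<noteq> x2\<close> by simp
qed

text \<open>Cramer's rule for the Vandermonde system of the interpolating parabola.\<close>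

lemma det_eq_parabola_coefficients:
  assumes "y2 = y1 + \<alpha> * (x2 - x1)"
    and "y3 = y1 + \<alpha> * (x3 - x1) + k * ((x3 - x1) * (x3 - x2))"
  shows "det_c2 x1 y1 x2 y2 x3 y3 = det_V x1 x2 x3 * k"
    and "det_c1 x1 y1 x2 y2 x3 y3 = det_V x1 x2 x3 * (\<alpha> - k * (x1 + x2))"
    and "det_c0 x1 y1 x2 y2 x3 y3 = det_V x1 x2 x3 * (y1 - \<alpha> * x1 + k * (x1 * x2))"
  unfolding det_V_eq det_c2_def det_c1_def det_c0_def det_3 assms
  by (simp_all add: vector_3 power2_eq_square algebra_simps)

theorem theorem1p4:
  fixes a b x1 y1 x2 y2 x3 y3 V c0 c1 c2 :: complex
    and P1 P2 P3 :: ec_point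
  assumes "4 * a ^ 3 + 27 * b\<^sup>2 \<noteq> 0"
    and "P1 = Affine x1 y1" and "P2 = Affine x2 y2" and "P3 = Affine x3 y3"
    and "P1 \<in> ec_curve a b" and "P2 \<in> ec_curve a b" and "P3 \<in> ec_curve a b"
    and "P1 \<noteq> P2" and "P1 \<noteq> ec_neg P2"
    and "P2 \<noteq> P3" and "P2 \<noteq> ec_neg P3"
    and "P1 \<noteq> P3" and "P1 \<noteq> ec_neg P3"
    and "ec_add a P1 P2 \<noteq> P3" and "ec_add a P1 P2 \<noteq> ec_neg P3"
    and "V = det_V x1 x2 x3"
    and "c0 = det_c0 x1 y1 x2 y2 x3 y3"
    and "c1 = det_c1 x1 y1 x2 y2 x3 y3"
    and "c2 = det_c2 x1 y1 x2 y2 x3 y3"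
  shows "V \<noteq> 0 \<and> c2 \<noteq> 0 \<and>
    (\<exists>x4 y4. ec_add a (ec_add a P1 P2) P3 = Affine x4 y4 \<and>
       x4 = - x1 - x2 - x3 + (V\<^sup>2 - 2 * c1 * c2) / c2\<^sup>2 \<and>
       y4 = - (c2 * x4\<^sup>2 + c1 * x4 + c0) / V)"
proof -
  have curve: "y1\<^sup>2 = x1 ^ 3 + a * x1 + b" "y2\<^sup>2 = x2 ^ 3 + a * x2 + b" "y3\<^sup>2 = x3 ^ 3 + a * x3 + b"
    using assms(2-7) by (auto simp: ec_curve_def)
  have x12: "x1 \<noteq> x2" and x23: "x2 \<noteq> x3" and x13: "x1 \<noteq> x3"
    using assms(2-13) ec_curve_distinct_abscissae by metis+
  define \<alpha> where "\<alpha> = (y2 - y1) / (x2 - x1)"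
  define L where "L x = y1 + \<alpha> * (x - x1)" for x
  define u where "u = - x1 - x2 + \<alpha>\<^sup>2"
  define k where "k = (y3 - L x3) / ((x3 - x1) * (x3 - x2))"
  have y2: "y2 = y1 + \<alpha> * (x2 - x1)"
    using x12 by (simp add: \<alpha>_def)
  have y3: "y3 = L x3 + k * ((x3 - x1) * (x3 - x2))"
    using x13 x23 by (simp add: k_def)
  have cubic: "x ^ 3 + a * x + b - (L x)\<^sup>2 = (x - x1) * (x - x2) * (x - u)" for x
    unfolding L_def u_def by (rule chord_cubic_factorization[OF curve(1,2) x12 y2])
  have P12: "ec_add a P1 P2 = Affine u (- L u)"
    using x12 by (simp add: assms(2,3) Let_def \<alpha>_def u_def L_def)
  have "Affine u (- L u) \<in> ec_curve a b"
    using cubic[of u] by (simp add: ec_curve_def)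
  then have ux3: "x3 \<noteq> u"
    using ec_curve_distinct_abscissae assms(4,7,14,15) P12 by metis
  have "((x3 - x1) * (x3 - x2)) * (x3 - u) = ((x3 - x1) * (x3 - x2)) * (k * (y3 + L x3))"
    using cubic[of x3] curve(3) y3 by algebra
  then have k_eq: "x3 - u = k * (y3 + L x3)"
    using x13 x23 by simp
  with ux3 have k0: "k \<noteq> 0"
    by auto
  have V0: "V \<noteq> 0"
    using x12 x23 x13 by (simp add: assms(16) det_V_eq)
  have c2: "c2 = V * k" and c1: "c1 = V * (\<alpha> - k * (x1 + x2))"
    and c0: "c0 = V * (y1 - \<alpha> * x1 + k * (x1 * x2))"
    unfolding assms(16-19)
    using det_eq_parabola_coefficients[OF y2 y3[unfolded L_def]] by blast+
  define \<beta> where "\<beta> = (y3 + L u) / (x3 - u)"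
  define x4 where "x4 = - u - x3 + \<beta>\<^sup>2"
  define y4 where "y4 = L u - \<beta> * (x4 - u)"
  have P4: "ec_add a (ec_add a P1 P2) P3 = Affine x4 y4"
    using ux3 by (simp add: P12 assms(4) Let_def \<beta>_def x4_def y4_def)
  have "\<beta> * (x3 - u) = y3 + L u"
    using ux3 by (simp add: \<beta>_def)
  \<comment> \<open>Use \<open>L x3 - L u = \<alpha> * (x3 - u)\<close>.\<close>
  then have "(x3 - u) * (k * (\<beta> + \<alpha>)) = (x3 - u) * 1"
    using k_eq L_def[of u] L_def[of x3] by algebra
  then have \<beta>: "k * (\<beta> + \<alpha>) = 1"
    using ux3 by simp
  \<comment> \<open>The square of \<open>\<alpha>\<close> in \<open>u\<close> cancels against the
    one from \<open>\<beta> = 1/k - \<alpha>\<close>.\<close>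
  have x4: "k\<^sup>2 * x4 = k\<^sup>2 * (x1 + x2 - x3) + 1 - 2 * k * \<alpha>"
    using \<beta> u_def x4_def by algebra
  have "c2\<^sup>2 * (x1 + x2 + x3 + x4) = V\<^sup>2 - 2 * c1 * c2"
    using x4 c1 c2 by algebra
  moreover have "c2 \<noteq> 0"
    using V0 k0 c2 by simp
  ultimately have "x1 + x2 + x3 + x4 = (V\<^sup>2 - 2 * c1 * c2) / c2\<^sup>2"
    by (simp add: eq_divide_eq mult.commute)
  then have X: "x4 = - x1 - x2 - x3 + (V\<^sup>2 - 2 * c1 * c2) / c2\<^sup>2"
    by (simp add: algebra_simps)
  \<comment> \<open>Dividing q^2 - f by (x - x1) (x - x2) leaves a quadratic: \<open>k_eq\<close>
    says that \<open>x3\<close> is a root, and \<open>x4\<close> is the other by the sum of the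
    roots.\<close>
  have root: "k\<^sup>2 * ((x4 - x1) * (x4 - x2)) + 2 * k * L x4 = x4 - u"
    using x4 k_eq y3 unfolding L_def by algebra
  have "k * y4 = k * (- (L x4 + k * ((x4 - x1) * (x4 - x2))))"
    using root \<beta> y4_def L_def[of u] L_def[of x4] by algebra
  then have "y4 = - (L x4 + k * ((x4 - x1) * (x4 - x2)))"
    using k0 by simp
  also have "L x4 + k * ((x4 - x1) * (x4 - x2)) = (c2 * x4\<^sup>2 + c1 * x4 + c0) / V"
  proof -
    have "V * (L x4 + k * ((x4 - x1) * (x4 - x2))) = c2 * x4\<^sup>2 + c1 * x4 + c0"
      unfolding c2 c1 c0 L_def by algebra
    then show ?thesis
      using V0 by (simp add: eq_divide_eq mult.commute)
  qed
  finally have Y: "y4 = - (c2 * x4\<^sup>2 + c1 * x4 + c0) / V"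
    by (simp only: minus_divide_left)
  show ?thesis
    using V0 k0 P4 X Y c2 by simp
qed

end
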